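(* $\bar n(t,3)<t+8$ for every integer $t\ge 0$.
   Context: An oriented matroid $M$ on a finite set $E$ is acyclic if it has no positive circuit. A reorientation of $M$ on $A\subseteq E$ is obtained by changing the signs of the elements of $A$ in all signed circuits of $M$; it is acyclic if the resulting oriented matroid is acyclic. An element $e$ of an acyclic oriented matroid is interior if there is a signed circuit $C=(C^+,C^-)$ with $C^-=\{e\}$. For integers $t\ge 0$, $d\ge 1$, $\bar n(t,d)$ is the largest integer $m$ such that every uniform oriented matroid of rank $d+1$ with $m$ elements has an acyclic reorientation with at most $t$ interior elements. *)

theory Defs
  imports Main "HOL-Library.Extended_Nat"
begin

text \<open>A signed set is a pair \<open>(X\<^sup>+, X\<^sup>-)\<close> of disjoint sets. An oriented matroid is given
  by its finite ground set \<open>E\<close> and its set \<open>\<C>\<close> of signed circuits.\<close>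

type_synonym 'a signed_set = "'a set \<times> 'a set"

definition opposite :: "'a signed_set \<Rightarrow> 'a signed_set" where
  "opposite X = (snd X, fst X)"

definition support :: "'a signed_set \<Rightarrow> 'a set" where
  "support X = fst X \<union> snd X"

text \<open>The signed circuit axioms; the last one is weak circuit elimination.\<close>

locale oriented_matroid =
  fixes E :: "'a set" and \<C> :: "'a signed_set set"
  assumes finite_ground: "finite E"
    and circuit_subset: "X \<in> \<C> \<Longrightarrow> support X \<subseteq> E"
    and circuit_disjoint: "X \<in> \<C> \<Longrightarrow> fst X \<inter> snd X = {}"
    and empty_not_circuit: "({}, {}) \<notin> \<C>"
    and circuit_opposite: "X \<in> \<C> \<Longrightarrow> opposite X \<in> \<C>"
    and circuit_incomparable:
      "X \<in> \<C> \<Longrightarrow> Y \<in> \<C> \<Longrightarrow> support X \<subseteq> support Y \<Longrightarrow> X = Y \<or> X = opposite Y"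
    and circuit_elimination:
      "X \<in> \<C> \<Longrightarrow> Y \<in> \<C> \<Longrightarrow> X \<noteq> opposite Y \<Longrightarrow> e \<in> fst X \<Longrightarrow> e \<in> snd Y \<Longrightarrow>
        \<exists>Z\<in>\<C>. fst Z \<subseteq> (fst X \<union> fst Y) - {e} \<and> snd Z \<subseteq> (snd X \<union> snd Y) - {e}"

text \<open>Independence, rank and uniformity refer to the underlying matroid, whose circuits are
  the supports of the signed circuits.\<close>

definition indep :: "'a set \<Rightarrow> 'a signed_set set \<Rightarrow> 'a set \<Rightarrow> bool" where
  "indep E \<C> I \<longleftrightarrow> I \<subseteq> E \<and> (\<forall>X\<in>\<C>. \<not> support X \<subseteq> I)"

definition om_rank :: "'a set \<Rightarrow> 'a signed_set set \<Rightarrow> nat" where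
  "om_rank E \<C> = Max (card ` {I. indep E \<C> I})"

definition uniform :: "'a set \<Rightarrow> 'a signed_set set \<Rightarrow> bool" where
  "uniform E \<C> \<longleftrightarrow> (\<forall>I\<subseteq>E. indep E \<C> I \<longleftrightarrow> card I \<le> om_rank E \<C>)"

definition acyclic_om :: "'a signed_set set \<Rightarrow> bool" where
  "acyclic_om \<C> \<longleftrightarrow> \<not> (\<exists>X\<in>\<C>. snd X = {})"

definition reorient_signed_set :: "'a set \<Rightarrow> 'a signed_set \<Rightarrow> 'a signed_set" where
  "reorient_signed_set A X = ((fst X - A) \<union> (snd X \<inter> A), (snd X - A) \<union> (fst X \<inter> A))"

definition reorient :: "'a set \<Rightarrow> 'a signed_set set \<Rightarrow> 'a signed_set set" where
  "reorient A \<C> = reorient_signed_set A ` \<C>"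

definition interior_elements :: "'a set \<Rightarrow> 'a signed_set set \<Rightarrow> 'a set" where
  "interior_elements E \<C> = {e \<in> E. \<exists>X\<in>\<C>. snd X = {e}}"

text \<open>Quantifying over ground sets of natural numbers is no restriction, since every finite
  set is in bijection with one.\<close>

definition reorientable_sizes :: "nat \<Rightarrow> nat \<Rightarrow> nat set" where
  "reorientable_sizes t d =
    {m. \<forall>(E :: nat set) \<C>.
          oriented_matroid E \<C> \<and> uniform E \<C> \<and> om_rank E \<C> = d + 1 \<and> card E = m \<longrightarrow>
          (\<exists>A\<subseteq>E. acyclic_om (reorient A \<C>) \<and>
                 card (interior_elements E (reorient A \<C>)) \<le> t)}"

text \<open>The largest size, as an extended natural number: it would be \<open>\<infinity>\<close> if
  there were no largest one, so a finite upper bound includes the claim that it exists.\<close>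

definition nbar :: "nat \<Rightarrow> nat \<Rightarrow> enat" where
  "nbar t d = Sup (enat ` reorientable_sizes t d)"

lemma zero_in_reorientable_sizes: "0 \<in> reorientable_sizes t d"
proof -
  have False
    if om: "oriented_matroid E \<C>" and rank: "om_rank E \<C> = d + 1" and card: "card E = 0"
    for E :: "nat set" and \<C>
  proof -
    have E: "E = {}"
      using oriented_matroid.finite_ground[OF om] card by simp
    have "indep E \<C> {}"
      using oriented_matroid.empty_not_circuit[OF om]
      by (auto simp: indep_def support_def)
    hence "{I. indep E \<C> I} = {{}}"
      using E by (auto simp: indep_def)
    thus False using rank by (simp add: om_rank_def)
  qed
  thus ?thesis unfolding reorientable_sizes_def by blast
qed

lemma nbar_eq_Max:
  assumes "finite (reorientable_sizes t d)"
  shows "nbar t d = enat (Max (reorientable_sizes t d))"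
proof -
  let ?S = "reorientable_sizes t d"
  have ne: "?S \<noteq> {}" using zero_in_reorientable_sizes by blast
  have "Sup (enat ` ?S) \<le> enat (Max ?S)"
    by (rule Sup_least) (use assms in auto)
  moreover have "enat (Max ?S) \<le> Sup (enat ` ?S)"
    by (rule Sup_upper) (use Max_in[OF assms ne] in blast)
  ultimately show ?thesis unfolding nbar_def by (rule antisym)
qed

end

theory Submission
  imports Complex_Main "HOL-Library.Infinite_Set" Defs
begin

text \<open>
  It suffices to find, for every \<open>n \<ge> 8\<close>, a uniform oriented matroid of rank 4 on \<open>n\<close> elements
  all of whose acyclic reorientations have at most 7 elements that are not interior: then at
  least \<open>n - 7\<close> elements are interior, which exceeds \<open>t\<close> once \<open>n \<ge> t + 8\<close>.

  The examples are Lawrence oriented matroids. Such an oriented matroid is given by a sign matrix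
  \<open>a\<close> with \<open>r\<close> rows and \<open>n\<close> columns; it is uniform of rank \<open>r\<close>, and the signs \<open>\<sigma>\<close> of the circuit on
  columns \<open>c\<^sub>0 < \<dots> < c\<^sub>r\<close> satisfy \<open>\<sigma>(c\<^sub>i) \<sigma>(c\<^sub>i\<^sub>+\<^sub>1) = - a\<^sub>i(c\<^sub>i) a\<^sub>i(c\<^sub>i\<^sub>+\<^sub>1)\<close> for \<open>i < r\<close>. So a positive
  circuit walks to the right through the columns and meets a sign change in row 0, then one in
  row 1, and so on. To see that these sign vectors form an oriented matroid, they are realised as
  the minimal linear dependencies of real vectors whose entries have the signs \<open>a\<close> and rapidly
  growing absolute values (\<open>dependency_signs\<close>, \<open>circuit_of_signs\<close>); that minimal dependencies
  satisfy the circuit axioms is \<open>oriented_matroid_circuits\<close>.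

  The matrix has two constant rows followed by two alternating rows. A reorientation changes the
  signs of columns, so its first two rows are equal to some sign sequence \<open>f\<close> and its last two rows
  to some \<open>g\<close>, where between adjacent columns exactly one of \<open>f\<close> and \<open>g\<close> changes sign. Call a
  column extreme if it is not interior. A circuit that has a given column as its only negative
  element is easiest to find with the sign changes at the end of the first two runs of \<open>f\<close> and at
  the start of the last two runs of \<open>g\<close>. Besides the first and the last, the extreme columns are
  therefore confined to the borders of these runs and to the places where the runs overlap. As a
  run of \<open>f\<close> and a run of \<open>g\<close> have at most one column in common, the overlaps are
  tiny, and the total is at most 7 (\<open>extreme_columns_le_7\<close>).
\<close>

section \<open>Oriented matroids of linear subspaces\<close>

definition sign_vector :: "('a \<Rightarrow> real) \<Rightarrow> 'a signed_set" where
  "sign_vector x = ({e. 0 < x e}, {e. x e < 0})"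

definition nonzeros :: "('a \<Rightarrow> real) \<Rightarrow> 'a set" where
  "nonzeros x = {e. x e \<noteq> 0}"

lemma support_sign_vector: "support (sign_vector x) = nonzeros x"
  by (auto simp: support_def sign_vector_def nonzeros_def)

lemma opposite_sign_vector: "opposite (sign_vector x) = sign_vector (\<lambda>e. - x e)"
  by (simp add: opposite_def sign_vector_def)

lemma sign_vector_scale_pos: "0 < t \<Longrightarrow> sign_vector (\<lambda>e. t * x e) = sign_vector x"
  by (auto simp: sign_vector_def zero_less_mult_iff mult_less_0_iff)

lemma sign_vector_scale_neg:
  "t < 0 \<Longrightarrow> sign_vector (\<lambda>e. t * x e) = opposite (sign_vector x)"
  by (auto simp: sign_vector_def opposite_def zero_less_mult_iff mult_less_0_iff)

definition conformal :: "('a \<Rightarrow> real) \<Rightarrow> ('a \<Rightarrow> real) \<Rightarrow> bool" where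
  "conformal x z \<longleftrightarrow> (\<forall>e. (0 < x e \<longrightarrow> 0 < z e) \<and> (x e < 0 \<longrightarrow> z e < 0))"

text \<open>A linear subspace \<open>D\<close> of \<open>\<real>\<^sup>E\<close> carries an oriented matroid whose circuits are the sign
  vectors of its nonzero elements of minimal support. Functions in \<open>D\<close> vanish outside \<open>E\<close>, so
  that a function stands for exactly one vector.\<close>

locale linear_subspace =
  fixes E :: "'a set" and D :: "('a \<Rightarrow> real) set"
  assumes finite_E: "finite E"
    and nonzeros_subset: "x \<in> D \<Longrightarrow> nonzeros x \<subseteq> E"
    and linear_combination: "x \<in> D \<Longrightarrow> y \<in> D \<Longrightarrow> (\<lambda>e. a * x e + b * y e) \<in> D"
begin

definition elementary :: "('a \<Rightarrow> real) \<Rightarrow> bool" where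
  "elementary x \<longleftrightarrow> x \<in> D \<and> nonzeros x \<noteq> {} \<and>
     (\<forall>y\<in>D. nonzeros y \<noteq> {} \<longrightarrow> \<not> nonzeros y \<subset> nonzeros x)"

definition circuits :: "'a signed_set set" where
  "circuits = sign_vector ` {x. elementary x}"

lemma finite_nonzeros: "x \<in> D \<Longrightarrow> finite (nonzeros x)"
  using nonzeros_subset finite_E finite_subset by metis

lemma elementary_uminus: "elementary x \<Longrightarrow> elementary (\<lambda>e. - x e)"
  using linear_combination[of x x "- 1" 0] by (simp add: elementary_def nonzeros_def)

text \<open>Subtracting the multiple of \<open>y\<close> that cancels one entry of \<open>x\<close> leaves a vector of smaller
  support than \<open>y\<close>, hence zero. This is where incomparability of circuits comes from.\<close>

lemma elementary_proportional:
  assumes x: "elementary x" and y: "elementary y" and sub: "nonzeros x \<subseteq> nonzeros y"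
  obtains t where "t \<noteq> 0" "x = (\<lambda>e. t * y e)"
proof -
  obtain e where e: "x e \<noteq> 0" using x by (auto simp: elementary_def nonzeros_def)
  with sub have ye: "y e \<noteq> 0" by (auto simp: nonzeros_def)
  define z where "z f = 1 * x f + (- (x e / y e)) * y f" for f
  have "z \<in> D"
    unfolding z_def by (rule linear_combination) (use x y in \<open>auto simp: elementary_def\<close>)
  moreover have "z e = 0" using ye by (simp add: z_def)
  moreover have "z f = 0" if "y f = 0" for f
    using that sub by (auto simp: z_def nonzeros_def)
  ultimately have "nonzeros z = {}"
    using y ye unfolding elementary_def nonzeros_def by blast
  then have zero: "z f = 0" for f by (auto simp: nonzeros_def)
  have "x = (\<lambda>f. (x e / y e) * y f)"
  proof
    show "x f = (x e / y e) * y f" for f using zero[of f] unfolding z_def by linarith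
  qed
  moreover have "x e / y e \<noteq> 0" using e ye by simp
  ultimately show thesis by (rule that[rotated])
qed

text \<open>Rockafellar's conformal reduction, which turns a linear combination into a circuit inside it.
  If \<open>z\<close> is not elementary, take \<open>w\<close> of smaller support that agrees in sign with \<open>z\<close> somewhere and
  move from \<open>z\<close> in the direction \<open>-w\<close> until the first entry vanishes: no sign has changed by
  then, and entries outside the support of \<open>w\<close> survive.\<close>

lemma conformal_elementary:
  assumes "z \<in> D" "nonzeros z \<noteq> {}"
  shows "\<exists>x. elementary x \<and> conformal x z"
  using assms
proof (induction "card (nonzeros z)" arbitrary: z rule: less_induct)
  case less
  show ?case
  proof (cases "elementary z")
    case True
    then show ?thesis by (auto simp: conformal_def)
  next
    case False
    then obtain y where y: "y \<in> D" "nonzeros y \<noteq> {}" "nonzeros y \<subset> nonzeros z"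
      using less.prems by (auto simp: elementary_def)
    obtain w where w: "w \<in> D" "nonzeros w \<subset> nonzeros z" "\<exists>e. 0 < w e * z e"
    proof -
      obtain e where "y e \<noteq> 0" "z e \<noteq> 0" using y by (auto simp: nonzeros_def)
      then consider "0 < y e * z e" | "0 < (- y e) * z e"
        by (metis linorder_neqE_linordered_idom mult_eq_0_iff mult_minus_left neg_0_less_iff_less)
      then show thesis
      proof cases
        case 1
        then show ?thesis using that[of y] y by blast
      next
        case 2
        have "(\<lambda>e. - y e) \<in> D" using linear_combination[OF y(1,1), of "- 1" 0] by simp
        moreover have "nonzeros (\<lambda>e. - y e) = nonzeros y" by (simp add: nonzeros_def)
        ultimately show ?thesis using that[of "\<lambda>e. - y e"] y(3) 2 by auto
      qed
    qed
    define P where "P = {e. 0 < w e * z e}"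
    have "finite P"
      by (rule finite_subset[OF _ finite_nonzeros[OF less.prems(1)]]) (auto simp: P_def nonzeros_def)
    moreover have "P \<noteq> {}" using w(3) by (simp add: P_def)
    ultimately obtain e0 where e0: "e0 \<in> P" "\<And>e. e \<in> P \<Longrightarrow> z e0 / w e0 \<le> z e / w e"
      using ex_min_if_finite[of "(\<lambda>e. z e / w e) ` P"] by (fastforce simp: not_less)
    \<comment> \<open>The minimal ratio is the first time at which an entry of \<open>z - t w\<close> vanishes.\<close>
    define t where "t = z e0 / w e0"
    have t: "0 < t" using e0(1) by (auto simp: P_def t_def zero_less_mult_iff zero_less_divide_iff)
    define z' where "z' e = 1 * z e + (- t) * w e" for e
    have z'D: "z' \<in> D" unfolding z'_def by (rule linear_combination) (use less.prems w in auto)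
    have z'e0: "z' e0 = 0" using e0(1) by (auto simp: z'_def t_def P_def)
    have zero: "z' e = 0" if "z e = 0" for e using that w(2) by (auto simp: z'_def nonzeros_def)
    have conf: "conformal z' z"
      unfolding conformal_def
    proof (intro allI)
      fix e
      show "(0 < z' e \<longrightarrow> 0 < z e) \<and> (z' e < 0 \<longrightarrow> z e < 0)"
      proof (cases "e \<in> P")
        case True
        then have "t \<le> z e / w e" using e0(2) by (simp add: t_def)
        with True show ?thesis
          by (auto simp: P_def z'_def zero_less_mult_iff field_simps)
      next
        case False
        consider "z e = 0" | "0 < z e" "w e \<le> 0" | "z e < 0" "0 \<le> w e"
          using False by (force simp: P_def zero_less_mult_iff not_less)
        then show ?thesis
        proof cases
          case 2
          then have "t * w e \<le> 0" using t by (simp add: mult_le_0_iff)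
          with 2 show ?thesis by (simp add: z'_def)
        next
          case 3
          then have "0 \<le> t * w e" using t by simp
          with 3 show ?thesis by (simp add: z'_def)
        qed (simp add: zero)
      qed
    qed
    have "e0 \<in> nonzeros z" "e0 \<notin> nonzeros z'" using e0(1) z'e0 by (auto simp: P_def nonzeros_def)
    then have "nonzeros z' \<subset> nonzeros z" using zero by (auto simp: nonzeros_def)
    then have "card (nonzeros z') < card (nonzeros z)"
      using finite_nonzeros[OF less.prems(1)] by (rule psubset_card_mono[rotated])
    moreover have "nonzeros z' \<noteq> {}"
    proof -
      obtain e where "z e \<noteq> 0" "w e = 0" using w(2) by (auto simp: nonzeros_def)
      then have "z' e \<noteq> 0" by (simp add: z'_def)
      then show ?thesis by (auto simp: nonzeros_def)
    qed
    ultimately obtain x where "elementary x" "conformal x z'"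
      using less.hyps[OF _ z'D] by blast
    with conf show ?thesis by (auto simp: conformal_def)
  qed
qed

text \<open>For elimination of \<open>e\<close>, the positive combination of \<open>x\<close> and \<open>y\<close> that vanishes at \<open>e\<close> has its
  signs among those of \<open>x\<close> and \<open>y\<close>; a circuit conformal to it is the required one.\<close>

lemma oriented_matroid_circuits: "oriented_matroid E circuits"
proof
  show "finite E" by (rule finite_E)
next
  fix X assume "X \<in> circuits"
  then obtain x where x: "elementary x" "X = sign_vector x" by (auto simp: circuits_def)
  show "support X \<subseteq> E"
    using x nonzeros_subset by (auto simp: support_sign_vector elementary_def)
  show "fst X \<inter> snd X = {}" using x by (auto simp: sign_vector_def)
  show "opposite X \<in> circuits"
    using x elementary_uminus by (auto simp: circuits_def opposite_sign_vector)
next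
  show "({}, {}) \<notin> circuits"
  proof
    assume "({}, {}) \<in> circuits"
    then obtain x where x: "elementary x" "sign_vector x = ({}, {})" by (auto simp: circuits_def)
    then have "nonzeros x = {}" using support_sign_vector[of x] by (simp add: support_def)
    with x show False by (simp add: elementary_def)
  qed
next
  fix X Y assume "X \<in> circuits" "Y \<in> circuits" and sub: "support X \<subseteq> support Y"
  then obtain x y where x: "elementary x" "X = sign_vector x" and y: "elementary y" "Y = sign_vector y"
    by (auto simp: circuits_def)
  obtain t where "t \<noteq> 0" "x = (\<lambda>e. t * y e)"
    using elementary_proportional[OF x(1) y(1)] sub x y by (auto simp: support_sign_vector)
  then show "X = Y \<or> X = opposite Y"
    unfolding x(2) y(2) using sign_vector_scale_pos[of t y] sign_vector_scale_neg[of t y]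
    by (cases "0 < t") simp_all
next
  fix X Y e
  assume "X \<in> circuits" "Y \<in> circuits" and ne: "X \<noteq> opposite Y" and e: "e \<in> fst X" "e \<in> snd Y"
  then obtain x y where x: "elementary x" "X = sign_vector x" and y: "elementary y" "Y = sign_vector y"
    by (auto simp: circuits_def)
  have xe: "0 < x e" and ye: "y e < 0" using e x y by (auto simp: sign_vector_def)
  define z where "z f = (- y e) * x f + x e * y f" for f
  have zD: "z \<in> D" unfolding z_def by (rule linear_combination) (use x y in \<open>auto simp: elementary_def\<close>)
  have "nonzeros z \<noteq> {}"
  proof
    assume "nonzeros z = {}"
    then have "(- y e) * x f + x e * y f = 0" for f by (simp add: nonzeros_def z_def)
    then have "x f = (x e / y e) * y f" for f using ye by (simp add: field_simps)
    then have "x = (\<lambda>f. (x e / y e) * y f)" by blast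
    moreover have "x e / y e < 0" using xe ye by (simp add: divide_pos_neg)
    ultimately have "sign_vector x = opposite (sign_vector y)" using sign_vector_scale_neg by metis
    with ne x y show False by simp
  qed
  then obtain w where w: "elementary w" "conformal w z" using conformal_elementary[OF zD] by blast
  have pos: "0 < x f \<or> 0 < y f" if "0 < z f" for f
  proof (rule ccontr)
    assume "\<not> ?thesis"
    then have "(- y e) * x f \<le> 0" "x e * y f \<le> 0" using xe ye by (auto simp: mult_le_0_iff zero_le_mult_iff)
    with that show False by (simp add: z_def)
  qed
  have neg: "x f < 0 \<or> y f < 0" if "z f < 0" for f
  proof (rule ccontr)
    assume "\<not> ?thesis"
    then have "0 \<le> (- y e) * x f" "0 \<le> x e * y f" using xe ye by (auto simp: mult_le_0_iff zero_le_mult_iff)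
    with that show False by (simp add: z_def)
  qed
  have "z e = 0" by (simp add: z_def)
  then have "fst (sign_vector w) \<subseteq> fst X \<union> fst Y - {e} \<and> snd (sign_vector w) \<subseteq> snd X \<union> snd Y - {e}"
    using w(2) pos neg unfolding x(2) y(2) conformal_def sign_vector_def by fastforce
  moreover have "sign_vector w \<in> circuits" using w(1) by (auto simp: circuits_def)
  ultimately show "\<exists>Z\<in>circuits. fst Z \<subseteq> fst X \<union> fst Y - {e} \<and> snd Z \<subseteq> snd X \<union> snd Y - {e}"
    by blast
qed

lemma uniform_circuits:
  assumes rank: "r \<le> card E"
    and long: "\<And>x. x \<in> D \<Longrightarrow> nonzeros x \<noteq> {} \<Longrightarrow> r < card (nonzeros x)"
    and dependent: "\<And>I. I \<subseteq> E \<Longrightarrow> r < card I \<Longrightarrow> \<exists>x\<in>D. nonzeros x \<noteq> {} \<and> nonzeros x \<subseteq> I"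
  shows "om_rank E circuits = r" "uniform E circuits"
proof -
  have indep: "indep E circuits I \<longleftrightarrow> card I \<le> r" if I: "I \<subseteq> E" for I
  proof
    assume ind: "indep E circuits I"
    show "card I \<le> r"
    proof (rule ccontr)
      assume "\<not> ?thesis"
      then obtain z where z: "z \<in> D" "nonzeros z \<noteq> {}" "nonzeros z \<subseteq> I"
        using dependent[OF I] by auto
      then obtain x where x: "elementary x" "conformal x z" using conformal_elementary by blast
      then have "nonzeros x \<subseteq> nonzeros z" by (auto simp: conformal_def nonzeros_def neq_iff)
      then have "support (sign_vector x) \<subseteq> I" using z(3) by (simp add: support_sign_vector)
      moreover have "sign_vector x \<in> circuits" using x(1) by (simp add: circuits_def)
      ultimately show False using ind by (auto simp: indep_def)
    qed
  next
    assume "card I \<le> r"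
    moreover have "card (nonzeros x) \<le> card I" if "nonzeros x \<subseteq> I" for x :: "'a \<Rightarrow> real"
      by (rule card_mono[OF finite_subset[OF I finite_E] that])
    ultimately show "indep E circuits I"
      using I long by (force simp: indep_def circuits_def support_sign_vector elementary_def)
  qed
  have sets: "{I. indep E circuits I} = {I. I \<subseteq> E \<and> card I \<le> r}"
    using indep by (auto simp: indep_def)
  obtain B where B: "B \<subseteq> E" "card B = r" using obtain_subset_with_card_n[OF rank] by metis
  show rk: "om_rank E circuits = r"
    unfolding om_rank_def sets
  proof (rule Max_eqI)
    show "finite (card ` {I. I \<subseteq> E \<and> card I \<le> r})" using finite_E by simp
    show "r \<in> card ` {I. I \<subseteq> E \<and> card I \<le> r}" using B by force
  qed auto
  show "uniform E circuits" unfolding uniform_def rk using indep by simp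
qed

end

text \<open>The coordinate vectors are the columns of \<open>v\<close>: coordinate \<open>i\<close> of the vector of \<open>e\<close> is \<open>v i e\<close>.\<close>

definition dependencies :: "'a set \<Rightarrow> nat \<Rightarrow> (nat \<Rightarrow> 'a \<Rightarrow> real) \<Rightarrow> ('a \<Rightarrow> real) set" where
  "dependencies E r v = {x. nonzeros x \<subseteq> E \<and> (\<forall>i<r. (\<Sum>e\<in>E. v i e * x e) = 0)}"

lemma linear_subspace_dependencies:
  assumes "finite E"
  shows "linear_subspace E (dependencies E r v)"
proof
  fix x y :: "'a \<Rightarrow> real" and a b :: real
  assume x: "x \<in> dependencies E r v" and y: "y \<in> dependencies E r v"
  have "nonzeros (\<lambda>e. a * x e + b * y e) \<subseteq> nonzeros x \<union> nonzeros y"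
    by (auto simp: nonzeros_def)
  moreover have "(\<Sum>e\<in>E. v i e * (a * x e + b * y e))
      = a * (\<Sum>e\<in>E. v i e * x e) + b * (\<Sum>e\<in>E. v i e * y e)" for i
    by (simp add: sum_distrib_left sum.distrib algebra_simps)
  ultimately show "(\<lambda>e. a * x e + b * y e) \<in> dependencies E r v"
    using x y by (auto simp: dependencies_def)
qed (use assms in \<open>auto simp: dependencies_def\<close>)

text \<open>Gaussian elimination: a column with nonzero last coordinate clears that coordinate in the
  others. A dependency of these in one dimension less then extends by a suitable coefficient of
  the clearing column.\<close>

lemma exists_dependency:
  fixes v :: "nat \<Rightarrow> 'a \<Rightarrow> real"
  assumes "finite A" "r < card A"
  shows "\<exists>x\<in>dependencies A r v. nonzeros x \<noteq> {}"
  using assms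
proof (induction r arbitrary: A v)
  case 0
  then obtain e where "e \<in> A" by fastforce
  then have "(\<lambda>f. if f = e then 1 else 0) \<in> dependencies A 0 v"
    by (auto simp: dependencies_def nonzeros_def)
  moreover have "nonzeros (\<lambda>f. if f = e then 1 else 0 :: real) \<noteq> {}" by (auto simp: nonzeros_def)
  ultimately show ?case by blast
next
  case (Suc r)
  show ?case
  proof (cases "\<forall>e\<in>A. v r e = 0")
    case True
    obtain x where "x \<in> dependencies A r v" "nonzeros x \<noteq> {}"
      using Suc.IH[of A v] Suc.prems by auto
    with True show ?thesis by (auto simp: dependencies_def less_Suc_eq)
  next
    case False
    then obtain e where e: "e \<in> A" "v r e \<noteq> 0" by auto
    define v' where "v' i f = v i f - v r f / v r e * v i e" for i f
    obtain x where x: "x \<in> dependencies (A - {e}) r v'" "nonzeros x \<noteq> {}"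
    proof -
      have "finite (A - {e})" "r < card (A - {e})" using Suc.prems e by auto
      then show thesis using Suc.IH[of "A - {e}" v'] that by blast
    qed
    define y where "y = x(e := - (\<Sum>f\<in>A - {e}. v r f * x f) / v r e)"
    have sum_y: "(\<Sum>f\<in>A. v i f * y f) = (\<Sum>f\<in>A - {e}. v' i f * x f)" for i
    proof -
      have "(\<Sum>f\<in>A. v i f * y f) = v i e * y e + (\<Sum>f\<in>A - {e}. v i f * x f)"
        using e Suc.prems(1) by (simp add: sum.remove[of A e] y_def)
      also have "v i e * y e = (\<Sum>f\<in>A - {e}. - (v r f / v r e * v i e) * x f)"
        by (simp add: y_def sum_distrib_left sum_divide_distrib sum_negf[symmetric] algebra_simps)
      finally show ?thesis by (simp add: v'_def sum.distrib[symmetric] algebra_simps)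
    qed
    have "(\<Sum>f\<in>A. v i f * y f) = 0" if "i < Suc r" for i
    proof (cases "i = r")
      case True
      then show ?thesis unfolding sum_y using e(2) by (simp add: v'_def)
    next
      case False
      then show ?thesis unfolding sum_y using that x(1) by (simp add: dependencies_def)
    qed
    moreover have "nonzeros y \<subseteq> A" "nonzeros x \<subseteq> nonzeros y"
      using x(1) e(1) by (auto simp: dependencies_def nonzeros_def y_def split: if_splits)
    ultimately show ?thesis using x(2) by (auto simp: dependencies_def)
  qed
qed

lemma dependencies_mono:
  assumes "finite E" "A \<subseteq> E" "x \<in> dependencies A r v"
  shows "x \<in> dependencies E r v"
proof -
  have "(\<Sum>e\<in>A. v i e * x e) = (\<Sum>e\<in>E. v i e * x e)" for i
    by (rule sum.mono_neutral_left) (use assms in \<open>auto simp: dependencies_def nonzeros_def\<close>)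
  with assms show ?thesis by (auto simp: dependencies_def)
qed

lemma dependencies_restrict:
  assumes "finite E" "A \<subseteq> E" "x \<in> dependencies E r v" "nonzeros x \<subseteq> A"
  shows "x \<in> dependencies A r v"
proof -
  have "(\<Sum>e\<in>A. v i e * x e) = (\<Sum>e\<in>E. v i e * x e)" for i
    by (rule sum.mono_neutral_left) (use assms in \<open>auto simp: nonzeros_def\<close>)
  with assms show ?thesis by (auto simp: dependencies_def)
qed

section \<open>Lawrence oriented matroids\<close>

text \<open>The largest and the smallest term of a vanishing sum: either sign must outweigh the other,
  so each of the two has at least \<open>1 / card C\<close> times the absolute value of any term.\<close>

lemma opposite_dominant_terms:
  fixes f :: "'a \<Rightarrow> real"
  assumes fin: "finite C" and sum: "sum f C = 0" and t: "t \<in> C" "f t \<noteq> 0"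
  obtains c d where "c \<in> C" "d \<in> C" "0 < f c" "f d < 0"
    "\<And>e. e \<in> C \<Longrightarrow> \<bar>f e\<bar> \<le> card C * \<bar>f c\<bar>" "\<And>e. e \<in> C \<Longrightarrow> \<bar>f e\<bar> \<le> card C * \<bar>f d\<bar>"
proof -
  have ex: "\<exists>d\<in>C. g d < 0 \<and> (\<forall>e\<in>C. g d \<le> g e \<and> g e \<le> card C * - g d)"
    if sum: "sum g C = 0" and t: "g t \<noteq> 0" for g :: "'a \<Rightarrow> real"
  proof -
    obtain d where d: "d \<in> C" "\<And>e. e \<in> C \<Longrightarrow> g d \<le> g e"
      using ex_min_if_finite[of "g ` C"] fin \<open>t \<in> C\<close> by (fastforce simp: not_less)
    have neg: "g d < 0"
    proof (rule ccontr)
      assume "\<not> g d < 0"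
      then have "\<forall>e\<in>C. 0 \<le> g e" using d by force
      then have "g t = 0" using sum_nonneg_eq_0_iff[OF fin] sum \<open>t \<in> C\<close> by blast
      with t show False by simp
    qed
    have "g e \<le> card C * - g d" if e: "e \<in> C" for e
    proof -
      have "g e = (\<Sum>f\<in>C - {e}. - g f)"
        using sum fin e by (simp add: sum.remove[of C e] sum_negf)
      also have "\<dots> \<le> card (C - {e}) * - g d"
        by (rule sum_bounded_above) (use d in auto)
      also have "\<dots> \<le> card C * - g d"
        using neg card_mono[OF fin, of "C - {e}"] by (intro mult_right_mono) auto
      finally show ?thesis .
    qed
    with d neg show ?thesis by blast
  qed
  obtain d where d: "d \<in> C" "f d < 0" "\<forall>e\<in>C. f d \<le> f e \<and> f e \<le> card C * - f d"
    using ex[of f] sum t by blast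
  obtain c where c: "c \<in> C" "- f c < 0" "\<forall>e\<in>C. - f c \<le> - f e \<and> - f e \<le> card C * - (- f c)"
    using ex[of "\<lambda>e. - f e"] sum t by (auto simp: sum_negf)
  have "1 \<le> real (card C)" using fin t(1) by (simp add: Suc_le_eq card_gt_0_iff) auto
  then have "- f d \<le> card C * - f d" "f c \<le> card C * f c"
    using c(2) d(2) mult_right_mono[of 1 "real (card C)" "- f d"] mult_right_mono[of 1 "real (card C)" "f c"]
    by simp_all
  then have bounds: "\<bar>f e\<bar> \<le> card C * \<bar>f c\<bar> \<and> \<bar>f e\<bar> \<le> card C * \<bar>f d\<bar>" if e: "e \<in> C" for e
  proof -
    have "f e \<le> f c" "- f e \<le> card C * f c" "f d \<le> f e" "f e \<le> card C * - f d"
      using c(3) d(3) e by auto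
    moreover have "\<bar>f c\<bar> = f c" "\<bar>f d\<bar> = - f d" using c(2) d(2) by auto
    ultimately show ?thesis
      using \<open>- f d \<le> card C * - f d\<close> \<open>f c \<le> card C * f c\<close> by (auto simp: abs_le_iff)
  qed
  show thesis
    by (rule that[of c d]) (use c(1,2) d(1,2) bounds in auto)
qed

text \<open>The Lawrence oriented matroid of a sign matrix \<open>a\<close> with \<open>r\<close> rows and columns \<open>1, \<dots>, n\<close>, realised
  by the columns of the matrix with entries \<open>a i j * base ^ (i * j)\<close>. A large base separates the
  orders of magnitude: among the terms of a dependency, passing from row \<open>i\<close> to row \<open>i + 1\<close>
  multiplies column \<open>j\<close> by \<open>base ^ j\<close> up to sign and thereby favours the later columns.\<close>

locale lawrence =
  fixes r n :: nat and a :: "nat \<Rightarrow> nat \<Rightarrow> real"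
  assumes r_pos: "0 < r" and r_less: "r < n" and unit: "\<bar>a i j\<bar> = 1"
begin

text \<open>The bound that the proof of \<open>dependency_signs\<close> uses is that the base exceeds the square of
  the number of columns in a circuit.\<close>

definition base :: real where "base = (real r + 1)\<^sup>2 + 1"

definition vectors :: "nat \<Rightarrow> nat \<Rightarrow> real" where
  "vectors i j = a i j * base ^ (i * j)"

sublocale linear_subspace "{1..n}" "dependencies {1..n} r vectors"
  by (rule linear_subspace_dependencies) simp

definition lawrence_circuits :: "nat signed_set set" where
  "lawrence_circuits = circuits"

lemma base_gt: "(real r + 1)\<^sup>2 < base" "1 < base"
  using r_pos by (simp_all add: base_def)

text \<open>This computes the signed circuits. In every row of a dependency on \<open>r + 1\<close> columns, two terms of
  opposite sign dominate all others up to the factor \<open>r + 1\<close>. By the growth of the entries, a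
  dominant column of row \<open>i + 1\<close> cannot lie before a dominant column of row \<open>i\<close>. So the pairs
  of dominant columns move to the right from row to row, sharing at most an end, and \<open>r\<close> such
  pairs only fit into \<open>r + 1\<close> columns if the pair of row \<open>i\<close> consists of columns \<open>i\<close> and \<open>i + 1\<close>.
  In particular no entry of the dependency vanishes.\<close>

lemma dependency_signs:
  assumes c: "strict_mono_on {..r} c" and x: "x \<in> dependencies (c ` {..r}) r vectors" "nonzeros x \<noteq> {}"
    and i: "i < r"
  shows "(a i (c i) * x (c i)) * (a i (c (Suc i)) * x (c (Suc i))) < 0"
proof -
  define f where "f i j = vectors i (c j) * x (c j)" for i j
  have sum: "(\<Sum>j\<le>r. f i j) = 0" if "i < r" for i
    using x(1) that strict_mono_on_imp_inj_on[OF c]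
    by (simp add: dependencies_def f_def sum.reindex)
  obtain t where t: "t \<le> r" "x (c t) \<noteq> 0"
    using x by (auto simp: dependencies_def nonzeros_def)
  have ft: "f i t \<noteq> 0" for i
    using t unit[of i "c t"] base_gt(2) by (auto simp: f_def vectors_def)
  have shift: "\<bar>f (Suc i) j\<bar> = base ^ c j * \<bar>f i j\<bar>" for i j
    using base_gt(2) unit by (simp add: f_def vectors_def abs_mult power_add)
  define dominant where "dominant i j k \<longleftrightarrow> j < k \<and> k \<le> r \<and> f i j * f i k < 0 \<and>
      (\<forall>e\<le>r. \<bar>f i e\<bar> \<le> (r + 1) * \<bar>f i j\<bar> \<and> \<bar>f i e\<bar> \<le> (r + 1) * \<bar>f i k\<bar>)" for i j k
  have "\<exists>j k. i < r \<longrightarrow> dominant i j k" for i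
  proof (cases "i < r")
    case True
    obtain j k where jk: "j \<le> r" "k \<le> r" "0 < f i j" "f i k < 0"
      "\<And>e. e \<le> r \<Longrightarrow> \<bar>f i e\<bar> \<le> (r + 1) * \<bar>f i j\<bar>" "\<And>e. e \<le> r \<Longrightarrow> \<bar>f i e\<bar> \<le> (r + 1) * \<bar>f i k\<bar>"
      using opposite_dominant_terms[of "{..r}" "f i" t] sum[OF True] t ft by auto
    show ?thesis
    proof (cases "j < k")
      case True
      then show ?thesis using jk by (intro exI[of _ j] exI[of _ k]) (simp add: dominant_def mult_less_0_iff)
    next
      case False
      then have "k < j" using jk by (cases "j = k") auto
      then show ?thesis using jk by (intro exI[of _ k] exI[of _ j]) (simp add: dominant_def mult_less_0_iff)
    qed
  qed simp
  then obtain lo hi where "dominant i (lo i) (hi i)" if "i < r" for i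
    by metis
  then have lo_hi: "lo i < hi i" "hi i \<le> r" "f i (lo i) * f i (hi i) < 0"
      "\<And>e. e \<le> r \<Longrightarrow> \<bar>f i e\<bar> \<le> (r + 1) * \<bar>f i (lo i)\<bar>"
      "\<And>e. e \<le> r \<Longrightarrow> \<bar>f i e\<bar> \<le> (r + 1) * \<bar>f i (hi i)\<bar>" if "i < r" for i
    using that unfolding dominant_def by blast+
  have hi_le_lo: "hi i \<le> lo (Suc i)" if i: "Suc i < r" for i
  proof (rule ccontr)
    define l where "l = lo (Suc i)"
    define h where "h = hi i"
    assume "\<not> hi i \<le> lo (Suc i)"
    then have less: "l < h" by (simp add: l_def h_def)
    have h: "h \<le> r" using lo_hi(2)[of i] i by (simp add: h_def)
    have pos: "0 < \<bar>f i h\<bar>" using lo_hi(3)[of i] i by (auto simp: h_def)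
    have "base ^ c h * \<bar>f i h\<bar> \<le> (r + 1) * (base ^ c l * \<bar>f i l\<bar>)"
      using lo_hi(4)[OF i h] by (simp add: shift l_def)
    also have "\<dots> \<le> (r + 1) * (base ^ c l * ((r + 1) * \<bar>f i h\<bar>))"
      using lo_hi(5)[of i l] i less h base_gt(2)
      by (intro mult_left_mono) (auto simp: h_def)
    also have "\<dots> = ((real r + 1)\<^sup>2 * base ^ c l) * \<bar>f i h\<bar>"
      by (simp add: power2_eq_square algebra_simps)
    finally have "base ^ c h \<le> (real r + 1)\<^sup>2 * base ^ c l" using pos by simp
    also have "\<dots> < base * base ^ c l" using base_gt by (intro mult_strict_right_mono) auto
    also have "\<dots> = base ^ Suc (c l)" by simp
    also have "\<dots> \<le> base ^ c h"
      using strict_mono_onD[OF c, of l h] less h base_gt(2) by (intro power_increasing) auto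
    finally show False by simp
  qed
  have lo_ge: "i \<le> lo i" if "i < r" for i
    using that
  proof (induction i)
    case (Suc i)
    then show ?case using hi_le_lo[of i] lo_hi(1)[of i] by linarith
  qed simp
  have hi_le: "hi i \<le> Suc i" if "i < r" for i
  proof -
    have "i \<le> r - 1" using that by simp
    then show ?thesis
    proof (induction i rule: inc_induct)
      case base
      then show ?case using lo_hi(2)[of "r - 1"] r_pos by simp
    next
      case (step i)
      then show ?case using hi_le_lo[of i] lo_hi(1)[of "Suc i"] by linarith
    qed
  qed
  have "lo i = i" "hi i = Suc i" using lo_ge[OF i] hi_le[OF i] lo_hi(1)[OF i] by linarith+
  with lo_hi(3)[OF i] have "f i i * f i (Suc i) < 0" by simp
  moreover have "f i i * f i (Suc i) = base ^ (i * c i + i * c (Suc i)) *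
      ((a i (c i) * x (c i)) * (a i (c (Suc i)) * x (c (Suc i))))"
    by (simp add: f_def vectors_def power_add)
  ultimately show ?thesis using base_gt(2) by (simp add: mult_less_0_iff)
qed

lemma dependency_nonzero:
  assumes "strict_mono_on {..r} c" "x \<in> dependencies (c ` {..r}) r vectors" "nonzeros x \<noteq> {}" "i \<le> r"
  shows "x (c i) \<noteq> 0"
proof (cases "i < r")
  case True
  then show ?thesis using dependency_signs[OF assms(1-3) True] by auto
next
  case False
  then have "i = Suc (r - 1)" using assms(4) r_pos by simp
  then show ?thesis using dependency_signs[OF assms(1-3), of "r - 1"] r_pos by auto
qed

lemma dependency_long:
  assumes x: "x \<in> dependencies {1..n} r vectors" "nonzeros x \<noteq> {}"
  shows "r < card (nonzeros x)"
proof (rule ccontr)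
  assume short: "\<not> ?thesis"
  obtain B where B: "nonzeros x \<subseteq> B" "B \<subseteq> {1..n}" "card B = Suc r"
    using exists_subset_between[of "nonzeros x" "Suc r" "{1..n}"] short r_less x nonzeros_subset
    by auto
  have "finite B" using B(2) finite_subset by blast
  then obtain c where c: "bij_betw c {..<card B} B" "strict_mono_on {..<card B} c"
    using ex_bij_betw_strict_mono_card by blast
  have cB: "c ` {..r} = B" "strict_mono_on {..r} c"
    using c B(3) by (simp_all add: lessThan_Suc_atMost bij_betw_def)
  have "x \<in> dependencies (c ` {..r}) r vectors"
    unfolding cB by (rule dependencies_restrict[OF _ B(2) x(1) B(1)]) simp
  from dependency_nonzero[OF cB(2) this x(2)] have "B \<subseteq> nonzeros x"
    using cB(1) by (auto simp: nonzeros_def)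
  then have "card B \<le> card (nonzeros x)" using finite_nonzeros[OF x(1)] by (rule card_mono[rotated])
  with short B(3) show False by simp
qed

lemma uniform_lawrence: "om_rank {1..n} circuits = r" "uniform {1..n} circuits"
proof -
  have "\<exists>x\<in>dependencies {1..n} r vectors. nonzeros x \<noteq> {} \<and> nonzeros x \<subseteq> I"
    if I: "I \<subseteq> {1..n}" "r < card I" for I
  proof -
    have "finite I" using I(1) finite_subset by blast
    then obtain x where x: "x \<in> dependencies I r vectors" "nonzeros x \<noteq> {}"
      using exists_dependency I(2) by blast
    then show ?thesis using dependencies_mono[OF _ I(1) x(1)] x(2) by (auto simp: dependencies_def)
  qed
  with uniform_circuits[of r] dependency_long r_less
  show "om_rank {1..n} circuits = r" "uniform {1..n} circuits" by auto
qed

text \<open>The converse of \<open>dependency_signs\<close>: the relations between consecutive signs determine the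
  sign vector on \<open>r + 1\<close> columns up to a global sign, so any pattern satisfying them is that of the
  dependency on these columns or of its negative. The factor \<open>s\<close> in the proof chooses between
  the two.\<close>

lemma circuit_of_signs:
  assumes c: "strict_mono_on {..r} c" "c ` {..r} \<subseteq> {1..n}"
    and \<sigma>: "\<And>i. i < r \<Longrightarrow> (a i (c i) * \<sigma> (c i)) * (a i (c (Suc i)) * \<sigma> (c (Suc i))) < 0"
  shows "({e \<in> c ` {..r}. 0 < \<sigma> e}, {e \<in> c ` {..r}. \<sigma> e < 0}) \<in> circuits"
proof -
  have card: "card (c ` {..r}) = Suc r"
    using card_image[OF strict_mono_on_imp_inj_on[OF c(1)]] by simp
  then obtain x where x: "x \<in> dependencies (c ` {..r}) r vectors" "nonzeros x \<noteq> {}"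
    using exists_dependency[of "c ` {..r}" r vectors] by auto
  define s where "s = \<sigma> (c 0) * x (c 0)"
  have "s \<noteq> 0"
    using \<sigma>[of 0] dependency_signs[OF c(1) x, of 0] r_pos by (auto simp: s_def)
  have same: "0 < s * (\<sigma> (c i) * x (c i))" if "i \<le> r" for i
    using that
  proof (induction i)
    case 0
    then show ?case using \<open>s \<noteq> 0\<close> by (auto simp: s_def[symmetric] zero_less_mult_iff linorder_neq_iff)
  next
    case (Suc i)
    have "0 < ((a i (c i) * x (c i)) * (a i (c (Suc i)) * x (c (Suc i)))) *
        ((a i (c i) * \<sigma> (c i)) * (a i (c (Suc i)) * \<sigma> (c (Suc i))))"
      by (rule mult_neg_neg) (use dependency_signs[OF c(1) x, of i] \<sigma>[of i] Suc.prems in auto)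
    also have "\<dots> = (a i (c i))\<^sup>2 * (a i (c (Suc i)))\<^sup>2 * ((\<sigma> (c i) * x (c i)) * (\<sigma> (c (Suc i)) * x (c (Suc i))))"
      by (simp add: power2_eq_square algebra_simps)
    also have "\<dots> = (\<sigma> (c i) * x (c i)) * (\<sigma> (c (Suc i)) * x (c (Suc i)))"
      using unit by (metis mult_1 power2_abs one_power2)
    finally have "0 < (\<sigma> (c i) * x (c i)) * (\<sigma> (c (Suc i)) * x (c (Suc i)))" .
    moreover have "0 < s * (\<sigma> (c i) * x (c i))" using Suc by simp
    moreover have "0 < s * v" if "0 < u * v" "0 < s * u" for u v :: real
      using that by (auto simp: zero_less_mult_iff)
    ultimately show ?case by blast
  qed
  define y where "y e = s * x e" for e
  have "y (c i) \<noteq> 0" if "i \<le> r" for i using same[OF that] by (auto simp: y_def)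
  then have nz: "nonzeros y = c ` {..r}"
    using x(1) by (auto simp: nonzeros_def y_def dependencies_def)
  have "x \<in> dependencies {1..n} r vectors" by (rule dependencies_mono[OF _ c(2) x(1)]) simp
  then have yD: "y \<in> dependencies {1..n} r vectors"
    using linear_combination[of x x s 0] by (simp add: y_def[abs_def])
  have "elementary y"
    unfolding elementary_def
  proof (intro conjI ballI impI)
    fix z assume z: "z \<in> dependencies {1..n} r vectors" "nonzeros z \<noteq> {}"
    show "\<not> nonzeros z \<subset> nonzeros y"
      using dependency_long[OF z] psubset_card_mono[of "nonzeros y" "nonzeros z"] finite_nonzeros[OF yD]
      by (auto simp: nz card)
  qed (use yD nz in auto)
  moreover have "sign_vector y = ({e \<in> c ` {..r}. 0 < \<sigma> e}, {e \<in> c ` {..r}. \<sigma> e < 0})"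
  proof -
    have "0 < y e \<longleftrightarrow> e \<in> c ` {..r} \<and> 0 < \<sigma> e" "y e < 0 \<longleftrightarrow> e \<in> c ` {..r} \<and> \<sigma> e < 0" for e
    proof -
      have "0 < y e \<longleftrightarrow> 0 < \<sigma> e" "y e < 0 \<longleftrightarrow> \<sigma> e < 0" if e: "e \<in> c ` {..r}"
      proof -
        have "0 < \<sigma> e * y e" using same e by (auto simp: y_def mult.left_commute)
        then show "0 < y e \<longleftrightarrow> 0 < \<sigma> e" "y e < 0 \<longleftrightarrow> \<sigma> e < 0" by (auto simp: zero_less_mult_iff)
      qed
      moreover have "y e = 0" if "e \<notin> c ` {..r}" using that nz by (auto simp: nonzeros_def)
      ultimately show "0 < y e \<longleftrightarrow> e \<in> c ` {..r} \<and> 0 < \<sigma> e"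
        "y e < 0 \<longleftrightarrow> e \<in> c ` {..r} \<and> \<sigma> e < 0" by (cases "e \<in> c ` {..r}"; simp)+
    qed
    then show ?thesis by (simp add: sign_vector_def)
  qed
  ultimately show ?thesis unfolding circuits_def by (metis imageI mem_Collect_eq)
qed

end

section \<open>Extreme columns\<close>

text \<open>The four-row matrices below have equal first and second rows, with signs \<open>f\<close>, and equal third
  and fourth rows, with signs \<open>g\<close>. The predicate says that one of the two opposite
  circuits on the columns \<open>c0 < c1 < c2 < c3 < c4\<close> is negative exactly at those in \<open>N\<close>: by the
  rule for Lawrence circuits, the signs of \<open>c\<^sub>i\<close> and \<open>c\<^sub>i\<^sub>+\<^sub>1\<close> in the circuit differ exactly if row \<open>i\<close> of the matrix
  has equal entries there.\<close>

definition sign_circuit ::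
  "(nat \<Rightarrow> bool) \<Rightarrow> (nat \<Rightarrow> bool) \<Rightarrow> nat \<Rightarrow> nat set \<Rightarrow> nat \<Rightarrow> nat \<Rightarrow> nat \<Rightarrow> nat \<Rightarrow> nat \<Rightarrow> bool" where
  "sign_circuit f g n N c0 c1 c2 c3 c4 \<longleftrightarrow>
     1 \<le> c0 \<and> c0 < c1 \<and> c1 < c2 \<and> c2 < c3 \<and> c3 < c4 \<and> c4 \<le> n \<and>
     ((f c0 = f c1) = ((c0 \<in> N) \<noteq> (c1 \<in> N))) \<and> ((f c1 = f c2) = ((c1 \<in> N) \<noteq> (c2 \<in> N))) \<and>
     ((g c2 = g c3) = ((c2 \<in> N) \<noteq> (c3 \<in> N))) \<and> ((g c3 = g c4) = ((c3 \<in> N) \<noteq> (c4 \<in> N)))"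

text \<open>The first column \<open>p\<close> after the run of \<open>f\<close> starting at \<open>a\<close>, with \<open>n + 1\<close> standing for a run that
  reaches the last column. Starting from \<open>a = n + 1\<close> gives \<open>n + 1\<close> again.\<close>

lemma run_end:
  fixes f :: "nat \<Rightarrow> bool"
  assumes "a \<le> Suc n"
  obtains p where "a \<le> p" "p \<le> Suc n" "\<And>j. a \<le> j \<Longrightarrow> j < p \<Longrightarrow> f j = f a"
    "p \<le> n \<Longrightarrow> a < p \<and> f p \<noteq> f a"
proof (cases "\<exists>j. a \<le> j \<and> j \<le> n \<and> f j \<noteq> f a")
  case True
  define p where "p = (LEAST j. a \<le> j \<and> j \<le> n \<and> f j \<noteq> f a)"
  have p: "a \<le> p \<and> p \<le> n \<and> f p \<noteq> f a"
    unfolding p_def using True by (rule LeastI_ex)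
  have "f j = f a" if "a \<le> j" "j < p" for j
    using not_less_Least[of j "\<lambda>j. a \<le> j \<and> j \<le> n \<and> f j \<noteq> f a"] that p
    unfolding p_def[symmetric] by auto
  moreover have "a < p" using p by (cases "p = a") auto
  moreover have "p \<le> Suc n" using p by simp
  ultimately show thesis using p by (intro that[of p]) blast+
next
  case False
  then have *: "f j = f a" if "a \<le> j" "j < Suc n" for j
    using that(1) that(2)[unfolded less_Suc_eq_le] by blast
  show thesis
  proof (rule that)
    show "f j = f a" if "a \<le> j" "j < Suc n" for j using that by (rule *)
  qed (use assms in simp_all)
qed

text \<open>The mirror image, where \<open>0\<close> stands for a run that reaches the first column.\<close>

lemma run_start:
  fixes g :: "nat \<Rightarrow> bool"
  obtains q where "q \<le> b" "\<And>j. q < j \<Longrightarrow> j \<le> b \<Longrightarrow> g j = g b"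
    "1 \<le> q \<Longrightarrow> q < b \<and> g q \<noteq> g b"
proof (cases "\<exists>j. 1 \<le> j \<and> j \<le> b \<and> g j \<noteq> g b")
  case True
  define q where "q = Max {j. 1 \<le> j \<and> j \<le> b \<and> g j \<noteq> g b}"
  have fin: "finite {j. 1 \<le> j \<and> j \<le> b \<and> g j \<noteq> g b}"
    by (rule finite_subset[of _ "{..b}"]) auto
  have q: "1 \<le> q \<and> q \<le> b \<and> g q \<noteq> g b"
    using Max_in[OF fin] True unfolding q_def by blast
  have "g j = g b" if "q < j" "j \<le> b" for j
    using Max_ge[OF fin, of j] that unfolding q_def[symmetric] by force
  moreover have "q < b" using q by (cases "q = b") auto
  ultimately show thesis using q by (intro that[of q]) blast+
next
  case False
  have *: "g j = g b" if "0 < j" "j \<le> b" for j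
  proof -
    have "1 \<le> j" using that(1) by simp
    with False that(2) show ?thesis by blast
  qed
  show thesis
  proof (rule that)
    show "g j = g b" if "0 < j" "j \<le> b" for j using that by (rule *)
  qed simp_all
qed

lemma card_le_5:
  assumes "M \<subseteq> {a, b, c, d, e}"
  shows "card M \<le> 5"
proof -
  have "card M \<le> card (set [a, b, c, d, e])" using assms by (intro card_mono) auto
  also have "\<dots> \<le> 5" using card_length[of "[a, b, c, d, e]"] by simp
  finally show ?thesis .
qed

text \<open>The combinatorial heart. Let the first two runs of \<open>f\<close> end before columns \<open>p\<close> and \<open>p'\<close>, and let
  the last two runs of \<open>g\<close> start after columns \<open>q\<close> and \<open>q'\<close>. These are the places where circuits
  find the sign changes that they need: of \<open>f\<close> as far left and of \<open>g\<close> as far right as possible.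
  With them, every column except the first and the last extreme one, \<open>p\<close>, \<open>q'\<close>, \<open>p'\<close>, \<open>q\<close> and
  those in the intervals \<open>[q', p]\<close> and \<open>[q, p']\<close> is seen to be interior. The hypothesis
  \<open>alternate\<close> says that between adjacent columns exactly one of \<open>f\<close> and \<open>g\<close> changes, so a run
  of \<open>f\<close> and a run of \<open>g\<close> share at most one column. Hence the intervals are so short that at most
  five columns remain.\<close>

lemma extreme_columns_le_7:
  fixes f g :: "nat \<Rightarrow> bool"
  assumes alternate: "\<And>j. f j = f (Suc j) \<longleftrightarrow> g j \<noteq> g (Suc j)"
    and acyclic: "\<And>c0 c1 c2 c3 c4. \<not> sign_circuit f g n {} c0 c1 c2 c3 c4"
    and X: "X \<subseteq> {1..n}"
    and extreme: "\<And>k c0 c1 c2 c3 c4. k \<in> X \<Longrightarrow> k \<in> {c0, c1, c2, c3, c4} \<Longrightarrow>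
      \<not> sign_circuit f g n {k} c0 c1 c2 c3 c4"
  shows "card X \<le> 7"
proof -
  have fin: "finite X" by (rule finite_subset[OF X]) simp
  define l where "l = Min X"
  define h where "h = Max X"
  define M where "M = X - {l, h}"
  have M: "k \<in> X \<and> l \<in> X \<and> h \<in> X \<and> l < k \<and> k < h \<and> 1 \<le> l \<and> h \<le> n" if "k \<in> M" for k
  proof -
    have k: "k \<in> X" "k \<noteq> l" "k \<noteq> h" using that by (auto simp: M_def)
    have "l \<in> X" "h \<in> X" using Min_in[OF fin] Max_in[OF fin] k unfolding l_def h_def by blast+
    moreover have "l \<le> k" "k \<le> h" using k fin unfolding l_def h_def by auto
    ultimately show ?thesis using k X by auto
  qed
  \<comment> \<open>If two sign changes of \<open>g\<close> follow \<open>k\<close>, then \<open>k\<close> is the first column with its value of \<open>f\<close>. Otherwise \<open>k\<close>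
    would be interior if \<open>f\<close> agrees at \<open>k\<close> and \<open>u\<close>; and if it does not, the circuit through \<open>l\<close>
    and \<open>k\<close> would be positive or make \<open>l\<close> interior.\<close>
  have early: "f c \<noteq> f k"
    if k: "k \<in> M" "k < u" "u < v" "v < w" "w \<le> n" "g u \<noteq> g v" "g v \<noteq> g w"
      and c: "1 \<le> c" "c < k" for k u v w c
  proof
    assume same: "f c = f k"
    note Mk = M[OF k(1)]
    show False
    proof (cases "f k = f u")
      case True
      then have "sign_circuit f g n {k} c k u v w"
        using k c same unfolding sign_circuit_def by simp
      then show False using extreme[of k c k u v w] Mk by simp
    next
      case False
      show False
      proof (cases "f l = f k")
        case True
        then have "sign_circuit f g n {l} l k u v w"
          using k Mk False unfolding sign_circuit_def by simp
        then show False using extreme[of l l k u v w] Mk by simp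
      next
        case neq: False
        then have "sign_circuit f g n {} l k u v w"
          using k Mk False unfolding sign_circuit_def by simp
        then show False using acyclic by blast
      qed
    qed
  qed
  \<comment> \<open>The mirror image of the previous step, with \<open>h\<close> in place of \<open>l\<close>.\<close>
  have late: "g c \<noteq> g k"
    if k: "k \<in> M" "1 \<le> u" "u < v" "v < w" "w < k" "f u \<noteq> f v" "f v \<noteq> f w"
      and c: "k < c" "c \<le> n" for k u v w c
  proof
    assume same: "g c = g k"
    note Mk = M[OF k(1)]
    show False
    proof (cases "g w = g k")
      case True
      then have "sign_circuit f g n {k} u v w k c"
        using k c same unfolding sign_circuit_def by simp
      then show False using extreme[of k u v w k c] Mk by simp
    next
      case False
      show False
      proof (cases "g k = g h")
        case True
        then have "sign_circuit f g n {h} u v w k h"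
          using k Mk False unfolding sign_circuit_def by simp
        then show False using extreme[of h u v w k h] Mk by simp
      next
        case neq: False
        then have "sign_circuit f g n {} u v w k h"
          using k Mk False unfolding sign_circuit_def by simp
        then show False using acyclic by blast
      qed
    qed
  qed
  have middle: False
    if "k \<in> M" "1 \<le> u" "u < v" "v < k" "k < w" "w < z" "z \<le> n" "f u \<noteq> f v" "f v = f k" "g k = g w" "g w \<noteq> g z"
    for k u v w z
  proof -
    have "sign_circuit f g n {k} u v k w z"
      using that unfolding sign_circuit_def by simp
    then show False using extreme[of k u v k w z] M[OF that(1)] by simp
  qed
  have clash: False if "f j = f b" "f (Suc j) = f b" "g j = g d" "g (Suc j) = g d" for j b d
    using that alternate[of j] by auto
  have "card M \<le> 5"
  proof (cases "M = {}")
    case False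
    then obtain k where "k \<in> M" by auto
    with M[OF this] have n: "1 \<le> n" by linarith
    obtain p where p: "1 \<le> p" "p \<le> Suc n" "\<And>j. 1 \<le> j \<Longrightarrow> j < p \<Longrightarrow> f j = f 1"
      "p \<le> n \<Longrightarrow> 1 < p \<and> f p \<noteq> f 1" using run_end[of 1 n f] by auto
    obtain p' where p': "p \<le> p'" "p' \<le> Suc n" "\<And>j. p \<le> j \<Longrightarrow> j < p' \<Longrightarrow> f j = f p"
      "p' \<le> n \<Longrightarrow> p < p' \<and> f p' \<noteq> f p" using run_end[of p n f] p(2) by auto
    obtain q where q: "q \<le> n" "\<And>j. q < j \<Longrightarrow> j \<le> n \<Longrightarrow> g j = g n"
      "1 \<le> q \<Longrightarrow> q < n \<and> g q \<noteq> g n" using run_start[of n g] by auto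
    obtain q' where q': "q' \<le> q" "\<And>j. q' < j \<Longrightarrow> j \<le> q \<Longrightarrow> g j = g q"
      "1 \<le> q' \<Longrightarrow> q' < q \<and> g q' \<noteq> g q" using run_start[of q g] by auto
    have p_ge_2: "2 \<le> p" using p n by linarith
    have at_p: "k = p" if k: "k \<in> M" "k < q'" for k
    proof -
      have *: "f c \<noteq> f k" if "1 \<le> c" "c < k" for c
        using early[OF k(1,2), of q n c] q(3) q'(1,3) k(2) that by linarith
      have "1 < k" "k < n" using M[OF k(1)] by auto
      with *[of 1] p(3)[of k] have "p \<le> k" by fastforce
      with *[of 1] *[of p] p(1,4) \<open>1 < k\<close> \<open>k < n\<close> show ?thesis by fastforce
    qed
    have at_q: "k = q" if k: "k \<in> M" "p' < k" for k
    proof -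
      have "1 < k" "k < n" using M[OF k(1)] by auto
      have *: "g c \<noteq> g k" if "k < c" "c \<le> n" for c
        using late[OF k(1), of 1 p p' c] p(4) p'(1,4) k(2) that \<open>k < n\<close> by fastforce
      from *[of n] q(2)[of k] \<open>k < n\<close> have "k \<le> q" by fastforce
      with *[of n] *[of q] q(1,3) \<open>1 < k\<close> \<open>k < n\<close> show ?thesis by fastforce
    qed
    have between: "k = p' \<or> k = q'" if k: "k \<in> M" "p < k" "k < q" for k
    proof (rule ccontr)
      assume "\<not> ?thesis"
      with k at_p[of k] at_q[of k] have "q' < k" "k < p'" by force+
      then have "f k = f p" "g k = g q" using k(2,3) p'(3)[of k] q'(2)[of k] by simp_all
      then show False
        using k(2,3) p(1,4) q(1,3) p_ge_2 middle[OF k(1), of 1 p q n] by force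
    qed
    \<comment> \<open>It remains to count; each of the following inequalities holds because two adjacent columns
      that violate it would lie in a common run of \<open>f\<close> and \<open>g\<close>, against \<open>clash\<close>.\<close>
    have sub: "k \<in> {p, q', p', q} \<union> {q'..p} \<union> {q..p'}" if "k \<in> M" for k
      using at_p[OF that] at_q[OF that] between[OF that] by force
    show ?thesis
    proof (cases "q + 2 \<le> p")
      case True
      have "p \<le> q + 2"
        using clash[of "q + 1" 1 n] p(1,2) q(1) p(3)[of "q + 1"] p(3)[of "q + 2"] q(2)[of "q + 1"] q(2)[of "q + 2"] by force
      moreover have "q \<le> q' + 1"
        using clash[of "q' + 1" 1 q] p(1,2) q(1) True p(3)[of "q' + 1"] p(3)[of "q' + 2"] q'(2)[of "q' + 1"] q'(2)[of "q' + 2"] by force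
      moreover have "p' \<le> p + 1"
        using clash[of "p" p n] p(1,2) q(1) True p'(1,2) p'(3)[of "p + 1"] q(2)[of "p"] q(2)[of "p + 1"] by force
      ultimately have "M \<subseteq> {q', q' + 1, q' + 2, q' + 3, q' + 4}"
        using sub True q'(1) p'(1) by fastforce
      then show ?thesis by (rule card_le_5)
    next
      case False
      have pq: "p \<le> q' + 2"
        using clash[of "q' + 1" 1 q] False p(3)[of "q' + 1"] p(3)[of "q' + 2"] q'(2)[of "q' + 1"] q'(2)[of "q' + 2"] by force
      have pq': "p' \<le> q + 2"
        using clash[of "q + 1" p n] False p'(1,2) p'(3)[of "q + 1"] p'(3)[of "q + 2"] q(2)[of "q + 1"] q(2)[of "q + 2"] by force
      consider "p \<le> q' + 1" | "p' \<le> q + 1" | "p = q' + 2" "p' = q + 2" using pq pq' by linarith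
      then show ?thesis
      proof cases
        case 1
        then have "M \<subseteq> {p, q', p', q, q + 1}" using sub pq' by fastforce
        then show ?thesis by (rule card_le_5)
      next
        case 2
        then have "M \<subseteq> {p, q', p', q, q' + 1}" using sub pq by fastforce
        then show ?thesis by (rule card_le_5)
      next
        case 3
        have "q \<le> p"
          using clash[of p p q] 3 p'(3)[of "p + 1"] q'(2)[of p] q'(2)[of "p + 1"] by force
        then have "M \<subseteq> {q', q' + 1, q' + 2, q' + 3, q' + 4}" using sub 3 False by fastforce
        then show ?thesis by (rule card_le_5)
      qed
    qed
  qed auto
  moreover have "card X \<le> card M + 2"
  proof -
    have "card X \<le> card (M \<union> {l, h})" by (rule card_mono) (use fin in \<open>auto simp: M_def\<close>)
    also have "\<dots> \<le> card M + card {l, h}" by (rule card_Un_le)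
    also have "card {l, h} \<le> 2" by (simp add: card_insert_if)
    finally show ?thesis by simp
  qed
  ultimately show ?thesis by linarith
qed

section \<open>The upper bound\<close>

text \<open>Two constant rows above two alternating ones. Reorienting multiplies columns by signs, which
  preserves the fact that between adjacent columns either the first two rows change sign or the
  last two do, but never both.\<close>

definition sign_rows :: "nat \<Rightarrow> nat \<Rightarrow> real" where
  "sign_rows i j = (if i < 2 then 1 else (- 1) ^ j)"

lemma lawrence_sign_rows: "4 < n \<Longrightarrow> lawrence 4 n sign_rows"
  by unfold_locales (auto simp: sign_rows_def power_abs)

text \<open>Negating the columns in \<open>A\<close> makes an entry of the first two rows positive if its column is
  not in \<open>A\<close>, and an entry of the last two rows if in addition its column is even or if neither
  holds; these are the sequences \<open>f\<close> and \<open>g\<close>.\<close>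

lemma reoriented_circuit:
  assumes n: "4 < n"
    and circ: "sign_circuit (\<lambda>j. j \<notin> A) (\<lambda>j. (j \<notin> A) = even j) n N c0 c1 c2 c3 c4"
  shows "({c0, c1, c2, c3, c4} - N, {c0, c1, c2, c3, c4} \<inter> N) \<in> reorient A (lawrence.lawrence_circuits 4 n sign_rows)"
proof -
  interpret lawrence 4 n sign_rows by (rule lawrence_sign_rows[OF n])
  define c where "c i = [c0, c1, c2, c3, c4] ! i" for i
  define \<sigma> :: "nat \<Rightarrow> real" where "\<sigma> e = (if (e \<in> A) = (e \<in> N) then 1 else - 1)" for e
  have ord: "1 \<le> c0" "c0 < c1" "c1 < c2" "c2 < c3" "c3 < c4" "c4 \<le> n"
    using circ by (simp_all add: sign_circuit_def)
  have range: "{..4} = {0, 1, 2, 3, 4 :: nat}" by auto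
  have img: "c ` {..4} = {c0, c1, c2, c3, c4}" unfolding range by (simp add: c_def)
  have mono: "strict_mono_on {..4} c"
    unfolding range using ord by (auto simp: strict_mono_on_def c_def)
  have row: "(p * \<sigma> e) * (p' * \<sigma> e') < 0"
    if "((e \<in> A) = (e' \<in> A)) = ((e \<in> N) \<noteq> (e' \<in> N)) \<longleftrightarrow> p * p' = 1" "p * p' = 1 \<or> p * p' = - 1"
    for p p' :: real and e e'
  proof -
    have "(p * \<sigma> e) * (p' * \<sigma> e') = (p * p') * (\<sigma> e * \<sigma> e')" by simp
    also have "\<dots> = - 1" using that by (auto simp: \<sigma>_def)
    finally show ?thesis by simp
  qed
  have parity: "(- 1) ^ j * (- 1) ^ k = (if even j = even k then 1 else - 1 :: real)" for j k :: nat
    by (simp add: uminus_power_if)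
  have signs: "(sign_rows i (c i) * \<sigma> (c i)) * (sign_rows i (c (Suc i)) * \<sigma> (c (Suc i))) < 0" if "i < 4" for i
  proof -
    have "i = 0 \<or> i = 1 \<or> i = 2 \<or> i = 3" using that by linarith
    moreover have "(p * \<sigma> c0) * (p * \<sigma> c1) < 0" "(p * \<sigma> c1) * (p * \<sigma> c2) < 0" if "p = 1" for p
      using circ that by (intro row; simp add: sign_circuit_def; fail)+
    moreover have "((- 1) ^ c2 * \<sigma> c2) * ((- 1) ^ c3 * \<sigma> c3) < 0"
      "((- 1) ^ c3 * \<sigma> c3) * ((- 1) ^ c4 * \<sigma> c4) < 0"
      using circ by (intro row; auto simp: sign_circuit_def parity; fail)+
    ultimately show ?thesis
      by (elim disjE) (simp_all add: sign_rows_def c_def numeral_2_eq_2 numeral_3_eq_3)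
  qed
  have "c ` {..4} \<subseteq> {1..n}" unfolding img using ord by auto
  from circuit_of_signs[OF mono this signs]
  have Z: "({e \<in> c ` {..4}. 0 < \<sigma> e}, {e \<in> c ` {..4}. \<sigma> e < 0}) \<in> circuits" .
  have eq: "reorient_signed_set A ({e \<in> c ` {..4}. 0 < \<sigma> e}, {e \<in> c ` {..4}. \<sigma> e < 0}) =
      ({c0, c1, c2, c3, c4} - N, {c0, c1, c2, c3, c4} \<inter> N)"
    unfolding img reorient_signed_set_def \<sigma>_def prod.inject fst_conv snd_conv
    by (intro conjI set_eqI) (auto split: if_splits)
  show ?thesis
    unfolding reorient_def lawrence_circuits_def eq[symmetric] using Z by (rule imageI)
qed

lemma few_extreme_elements:
  assumes n: "4 < n" and acyclic: "acyclic_om (reorient A (lawrence.lawrence_circuits 4 n sign_rows))"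
  shows "n \<le> card (interior_elements {1..n} (reorient A (lawrence.lawrence_circuits 4 n sign_rows))) + 7"
proof -
  let ?\<C> = "reorient A (lawrence.lawrence_circuits 4 n sign_rows)"
  let ?f = "\<lambda>j. j \<notin> A" and ?g = "\<lambda>j. (j \<notin> A) = even j"
  let ?I = "interior_elements {1..n} ?\<C>"
  have "card ({1..n} - ?I) \<le> 7"
  proof (rule extreme_columns_le_7[of ?f ?g n])
    show "\<not> sign_circuit ?f ?g n {} c0 c1 c2 c3 c4" for c0 c1 c2 c3 c4
      using reoriented_circuit[OF n, of A "{}"] acyclic by (fastforce simp: acyclic_om_def)
    show "\<not> sign_circuit ?f ?g n {k} c0 c1 c2 c3 c4"
      if k: "k \<in> {1..n} - ?I" "k \<in> {c0, c1, c2, c3, c4}" for k c0 c1 c2 c3 c4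
    proof
      assume "sign_circuit ?f ?g n {k} c0 c1 c2 c3 c4"
      from reoriented_circuit[OF n this] obtain Z where "Z \<in> ?\<C>" "snd Z = {k}"
        using k(2) by force
      with k(1) show False by (auto simp: interior_elements_def)
    qed
  qed auto
  moreover have "card ({1..n} - ?I) = n - card ?I"
    by (subst card_Diff_subset) (auto simp: interior_elements_def intro: finite_subset[of _ "{1..n}"])
  ultimately show ?thesis by linarith
qed

theorem theorem5:
  fixes t :: nat
  shows "nbar t 3 < enat (t + 8)"
proof -
  have "m \<le> t + 7" if m: "m \<in> reorientable_sizes t 3" for m
  proof (rule ccontr)
    assume large: "\<not> ?thesis"
    then have 4: "4 < m" by simp
    interpret lawrence 4 m sign_rows by (rule lawrence_sign_rows[OF 4])
    have "oriented_matroid {1..m} lawrence_circuits" "uniform {1..m} lawrence_circuits" "om_rank {1..m} lawrence_circuits = 3 + 1"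
      using oriented_matroid_circuits uniform_lawrence by (simp_all add: lawrence_circuits_def)
    moreover have "card {1..m} = m" by simp
    ultimately obtain A where "acyclic_om (reorient A lawrence_circuits)"
      "card (interior_elements {1..m} (reorient A lawrence_circuits)) \<le> t"
      using m unfolding reorientable_sizes_def mem_Collect_eq by blast
    with few_extreme_elements[OF 4, of A] large show False by simp
  qed
  then have "nbar t 3 \<le> enat (t + 7)"
    unfolding nbar_def by (intro Sup_least) auto
  also have "\<dots> < enat (t + 8)" by simp
  finally show ?thesis .
qed

end
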